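(* There exists a constant $b_2>0$ such that the following holds. Let $\mathcal{M}_1$ and $\mathcal{M}_2$ be two finite sets of distinct positive integers, and write $N_1 = \# \mathcal{M}_1$ and $N_2 = \# \mathcal{M}_2$. Assume that $N_1 \leq N_2$. Assume furthermore that $\mathcal{M}_1 \subset [2^{k_1},2^{k_1+1}]$ and $\mathcal{M}_2 \subset [2^{k_2},2^{k_2+1}]$ for some positive integers $k_1,k_2$. Let $R>1$ be a real number. Then $$ \sum_{\substack{m \in \mathcal{M}_1,\ n \in \mathcal{M}_2,\\ R \leq (m,n) \leq R \log N_2}} \frac{(m,n)^{1/2}}{(mn)^{1/4}} \leq (N_1 N_2)^{3/4} (\log N_2)^{b_2}, $$ provided that $N_1$ and $N_2$ are sufficiently large.
   Context: $(m,n)$ denotes the greatest common divisor of $m$ and $n$. Convention: $\log x$ is understood as $\max(1,\log x)$. "Sufficiently large" means larger than some absolute constant. *)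

theory Defs
  imports Complex_Main
begin

text \<open>The natural logarithm truncated from below at \<open>1\<close>.\<close>

definition log1 :: "real \<Rightarrow> real" where
  "log1 x = max 1 (ln x)"

end

theory Submission
  imports Defs "HOL-Computational_Algebra.Primes"
begin

text \<open>
  Put \<open>v\<^sub>p\<close> for the \<open>p\<close>-adic valuation. The weight \<open>(m,n)\<^bsup>1/2\<^esup> / (mn)\<^bsup>1/4\<^esup>\<close> is the product over all
  primes \<open>p\<close> of \<open>p\<^bsup>-|v\<^sub>p(m) - v\<^sub>p(n)|/4\<^esup>\<close>, so it is a tensor product of kernels \<open>t\<^bsup>|i-j|\<^esup>\<close> on the
  natural numbers with \<open>t = p\<^bsup>-1/4\<^esup>\<close>. All terms are nonnegative, so the sum may be extended to
  all of \<open>M1 \<times> M2\<close>. Four facts then combine.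

  \<^item> For a single prime, the kernel maps \<open>l\<^bsup>4/3\<^esup>\<close> to \<open>l\<^sup>4\<close> with norm \<open>1 + O(t\<^sup>4) = 1 + O(1/p)\<close>
    (\<open>geometric_kernel_bound\<close>). The absence of terms of lower order in \<open>t\<close> is the heart of
    the matter: it is a hypercontractive phenomenon, and \<open>4/3\<close> is the exponent for which the loss is
    of order \<open>1/p\<close>.

  \<^item> Such a bound tensorizes. When the valuations at the primes of a finite set \<open>T\<close> tell the elements
    of \<open>A\<close> apart, and likewise for \<open>B\<close>, the sum of the kernel over \<open>A \<times> B\<close> is at most
    \<open>(|A| |B|)\<^bsup>3/4\<^esup>\<close> times the product of the norms over \<open>p \<in> T\<close> (\<open>product_kernel_bound\<close>).

  \<^item> Only \<open>|A| + |B|\<close> primes are needed. Each local factor is at most \<open>1\<close>, so discarding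
    primes only enlarges the kernel (\<open>gcd_weight_le_prime_kernel\<close>), and a set of \<open>|A|\<close> primes can be
    found that still tells the elements of \<open>A\<close> apart (\<open>few_coordinates_separate\<close>, a form of Bondy's
    theorem). This makes the loss depend on the sizes of the sets only.

  \<^item> Over a set of \<open>N\<close> primes, the sum of \<open>1/p\<close> is at most \<open>2 log log N + O(1)\<close>, by
    Chebyshev's argument with central binomial coefficients (\<open>sum_prime_reciprocals_le\<close>).

  Hence the total loss is at most \<open>exp (O(log log N2))\<close>, which is a power of \<open>log N2\<close>.
\<close>

section \<open>The geometric kernel on the natural numbers\<close>

text \<open>
  The distance \<open>|i - j|\<close>. As subtraction on \<^typ>\<open>nat\<close> is truncated, one of the two summands vanishes;
  this form avoids a detour through the integers.
\<close>

definition gap :: "nat \<Rightarrow> nat \<Rightarrow> nat" where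
  "gap i j = (i - j) + (j - i)"

lemma gap_self [simp]: "gap i i = 0"
  by (simp add: gap_def)

lemma gap_commute: "gap i j = gap j i"
  by (simp add: gap_def)

lemma sum_power_pos_le:
  fixes t :: real
  assumes "finite S" "0 \<notin> S" "0 \<le> t" "t < 1"
  shows "(\<Sum>n\<in>S. t ^ n) \<le> t / (1 - t)"
proof -
  have "(\<Sum>n\<in>insert 0 S. t ^ n) \<le> (\<Sum>n. t ^ n)"
    using assms by (intro sum_le_suminf summable_geometric) auto
  also have "\<dots> = 1 / (1 - t)"
    using assms by (intro suminf_geometric) auto
  finally have "(\<Sum>n\<in>S. t ^ n) \<le> 1 / (1 - t) - 1"
    using assms by simp
  also have "\<dots> = t / (1 - t)"
    using assms by (simp add: field_simps)
  finally show ?thesis .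
qed

lemma sum_power_gap_le:
  fixes t :: real
  assumes "finite J" "x \<notin> J" "0 \<le> t" "t < 1"
  shows "(\<Sum>j\<in>J. t ^ gap x j) \<le> 2 * t / (1 - t)"
proof -
  let ?L = "{j\<in>J. j < x}" and ?U = "{j\<in>J. x < j}"
  have J: "J = ?L \<union> ?U"
    using assms(2) by (auto simp: not_less_iff_gr_or_eq)
  have "(\<Sum>j\<in>J. t ^ gap x j) = (\<Sum>j\<in>?L. t ^ gap x j) + (\<Sum>j\<in>?U. t ^ gap x j)"
    using assms(1) by (subst J, subst sum.union_disjoint) auto
  also have "(\<Sum>j\<in>?L. t ^ gap x j) = (\<Sum>n\<in>(\<lambda>j. x - j) ` ?L. t ^ n)"
    by (subst sum.reindex) (auto simp: inj_on_def gap_def intro!: sum.cong)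
  also have "(\<Sum>j\<in>?U. t ^ gap x j) = (\<Sum>n\<in>(\<lambda>j. j - x) ` ?U. t ^ n)"
    by (subst sum.reindex) (auto simp: inj_on_def gap_def intro!: sum.cong)
  also have "(\<Sum>n\<in>(\<lambda>j. x - j) ` ?L. t ^ n) + (\<Sum>n\<in>(\<lambda>j. j - x) ` ?U. t ^ n)
      \<le> t / (1 - t) + t / (1 - t)"
    using assms by (intro add_mono sum_power_pos_le) auto
  finally show ?thesis by simp
qed

text \<open>
  Schur's test: the off-diagonal part of the kernel has row and column sums at most \<open>2t / (1 - t)\<close>, so
  this is also a bound for its norm on \<open>l\<^sup>2\<close>. It handles the part of \<open>f\<close> and \<open>g\<close> away from their
  common peak.
\<close>

lemma off_diagonal_Schur:
  fixes t :: real and F G :: "nat \<Rightarrow> real"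
  assumes J: "finite J" and t: "0 \<le> t" "t < 1"
  shows "(\<Sum>i\<in>J. \<Sum>j\<in>J - {i}. t ^ gap i j * (F i * G j))
      \<le> 2 * t / (1 - t) * (((\<Sum>i\<in>J. (F i)\<^sup>2) + (\<Sum>j\<in>J. (G j)\<^sup>2)) / 2)"
proof -
  let ?\<kappa> = "2 * t / (1 - t)"
  have row: "(\<Sum>j\<in>J - {i}. t ^ gap i j) \<le> ?\<kappa>" for i
    using assms by (intro sum_power_gap_le) auto
  have bound: "(\<Sum>i\<in>J. \<Sum>j\<in>J - {i}. t ^ gap i j * (H i)\<^sup>2) \<le> ?\<kappa> * (\<Sum>i\<in>J. (H i)\<^sup>2)"
    for H :: "nat \<Rightarrow> real"
    unfolding sum_distrib_left sum_distrib_right[symmetric]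
    by (intro sum_mono mult_right_mono row) auto
  have swap: "(\<Sum>i\<in>J. \<Sum>j\<in>J - {i}. t ^ gap i j * (G j)\<^sup>2)
      = (\<Sum>i\<in>J. \<Sum>j\<in>J - {i}. t ^ gap i j * (G i)\<^sup>2)"
  proof -
    have off: "J - {i} = {j\<in>J. j \<noteq> i}" "{j\<in>J. i \<noteq> j} = J - {i}" for i by auto
    have "(\<Sum>i\<in>J. \<Sum>j\<in>J - {i}. t ^ gap i j * (G j)\<^sup>2)
       = (\<Sum>j\<in>J. \<Sum>i\<in>J - {j}. t ^ gap i j * (G j)\<^sup>2)"
      unfolding off(1) by (subst sum.swap_restrict[OF J J]) (simp add: eq_commute)
    then show ?thesis by (simp add: gap_commute)
  qed
  have "F i * G j \<le> ((F i)\<^sup>2 + (G j)\<^sup>2) / 2" for i j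
    using sum_squares_bound[of "F i" "G j"] by simp
  then have "(\<Sum>i\<in>J. \<Sum>j\<in>J - {i}. t ^ gap i j * (F i * G j))
      \<le> (\<Sum>i\<in>J. \<Sum>j\<in>J - {i}. t ^ gap i j * (((F i)\<^sup>2 + (G j)\<^sup>2) / 2))"
    using t by (intro sum_mono mult_left_mono) auto
  also have "\<dots> = ((\<Sum>i\<in>J. \<Sum>j\<in>J - {i}. t ^ gap i j * (F i)\<^sup>2)
      + (\<Sum>i\<in>J. \<Sum>j\<in>J - {i}. t ^ gap i j * (G j)\<^sup>2)) / 2"
    by (simp add: sum.distrib sum_divide_distrib distrib_left add_divide_distrib)
  also have "\<dots> \<le> (?\<kappa> * (\<Sum>i\<in>J. (F i)\<^sup>2) + ?\<kappa> * (\<Sum>i\<in>J. (G i)\<^sup>2)) / 2"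
    unfolding swap using bound[of F] bound[of G] by simp
  finally show ?thesis by (simp add: distrib_left)
qed

text \<open>
  The competition that decides the order of the loss: mass \<open>u\<^sup>4\<close> moved away from the peak costs a fixed
  multiple of \<open>u\<^sup>4\<close> on the diagonal and gains a multiple of \<open>k u\<^sup>3\<close> off it. The gain exceeds the
  cost only for \<open>u \<le> 12 k\<close>, and then it is \<open>O(k\<^sup>4)\<close>.
\<close>

lemma cubic_quartic_tradeoff:
  fixes k u :: real
  assumes "0 \<le> k" "0 \<le> u"
  shows "3 / 2 * k * u ^ 3 \<le> u ^ 4 / 8 + 2592 * k ^ 4"
proof (cases "u \<le> 12 * k")
  case True
  have "3 / 2 * k * u ^ 3 \<le> 3 / 2 * k * (12 * k) ^ 3"
    using True assms by (intro mult_left_mono power_mono) auto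
  also have "\<dots> = 2592 * k ^ 4"
    by (simp add: power_mult_distrib power3_eq_cube power4_eq_xxxx)
  finally show ?thesis by (rule order_trans) simp
next
  case False
  then have "3 / 2 * k * u ^ 3 \<le> u / 8 * u ^ 3"
    using assms by (intro mult_right_mono) auto
  also have "\<dots> = u ^ 4 / 8" by (simp add: power3_eq_cube power4_eq_xxxx)
  finally show ?thesis by (rule order_trans) simp
qed

text \<open>
  In terms of \<open>a = f\<^sup>4\<close> and \<open>b = g\<^sup>4\<close> this concerns probability vectors \<open>a\<close>, \<open>b\<close> and their powers
  \<open>a\<^bsup>3/4\<^esup>\<close>, \<open>b\<^bsup>3/4\<^esup>\<close>; fourth roots keep all the exponents integral. Let \<open>x\<close> be the index where
  \<open>f i * g i\<close> is largest, and let \<open>u\<^sup>4\<close>, \<open>v\<^sup>4\<close> be the masses of \<open>a\<close>, \<open>b\<close> off \<open>x\<close>. The diagonal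
  contributes at most \<open>f x * g x\<close>, hence at most \<open>1 - (u\<^sup>4 + v\<^sup>4) / 8\<close>. Every off-diagonal term has
  an index other than \<open>x\<close>, so together they are at most \<open>3/2 \<kappa> (u\<^sup>3 + v\<^sup>3)\<close> where
  \<open>\<kappa> = 2t / (1 - t)\<close>. The trade-off above concludes. The argument is valid for
  all \<open>0 \<le> t < 1\<close>, so it serves the small primes as well.
\<close>

lemma geometric_kernel_bound_normalized:
  fixes t :: real and f g :: "nat \<Rightarrow> real"
  assumes I: "finite I" and t: "0 \<le> t" "t < 1"
    and f0: "\<And>i. i \<in> I \<Longrightarrow> 0 \<le> f i" and g0: "\<And>i. i \<in> I \<Longrightarrow> 0 \<le> g i"
    and f1: "(\<Sum>i\<in>I. f i ^ 4) = 1" and g1: "(\<Sum>i\<in>I. g i ^ 4) = 1"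
  shows "(\<Sum>i\<in>I. \<Sum>j\<in>I. t ^ gap i j * (f i ^ 3 * g j ^ 3)) \<le> 1 + 5184 * (2 * t / (1 - t)) ^ 4"
proof -
  define \<kappa> where "\<kappa> = 2 * t / (1 - t)"
  have \<kappa>0: "0 \<le> \<kappa>" using t by (simp add: \<kappa>_def)
  have "I \<noteq> {}" using f1 by auto
  then have "Max ((\<lambda>i. f i * g i) ` I) \<in> (\<lambda>i. f i * g i) ` I"
    using I by (intro Max_in) auto
  then obtain x where x: "x \<in> I" and xMax: "f x * g x = Max ((\<lambda>i. f i * g i) ` I)"
    by auto
  have xmax: "f i * g i \<le> f x * g x" if "i \<in> I" for i
    unfolding xMax using that I by (intro Max_ge) auto
  define J where "J = I - {x}"
  have J: "finite J" "x \<notin> J" "J \<subseteq> I" using I by (auto simp: J_def)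
  have I_eq: "I = insert x J" using x by (auto simp: J_def)
  define u where "u = root 4 (\<Sum>i\<in>J. f i ^ 4)"
  define v where "v = root 4 (\<Sum>i\<in>J. g i ^ 4)"
  have u0: "0 \<le> u" and v0: "0 \<le> v"
    by (simp_all add: u_def v_def sum_nonneg)
  have u4: "(\<Sum>i\<in>J. f i ^ 4) = u ^ 4" and v4: "(\<Sum>i\<in>J. g i ^ 4) = v ^ 4"
    by (simp_all add: u_def v_def sum_nonneg)
  have fx: "f x ^ 4 = 1 - u ^ 4" and gx: "g x ^ 4 = 1 - v ^ 4"
    using f1 g1 J unfolding I_eq by (simp_all add: u4 v4)
  \<comment> \<open>Applied to the value \<open>h\<close> of \<open>f\<close> or \<open>g\<close> at \<open>x\<close>; Bernoulli linearizes the fourth root of \<open>1 - w\<^sup>4\<close>.\<close>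
  have peak: "h \<le> 1 - w ^ 4 / 4 \<and> h \<le> 1 \<and> w \<le> 1"
    if "h ^ 4 = 1 - w ^ 4" "0 \<le> h" "0 \<le> w" for h w :: real
  proof -
    have "h ^ 4 \<le> 1 ^ 4" "w ^ 4 \<le> 1 ^ 4"
      using that(1) zero_le_even_power[of 4 h] zero_le_even_power[of 4 w] by auto
    then have h1: "h \<le> 1" and w1: "w \<le> 1"
      using that(2,3) power_mono_iff[of _ 1 4] by auto
    have "1 + real 4 * (- (w ^ 4 / 4)) \<le> (1 + (- (w ^ 4 / 4))) ^ 4"
      using power_le_one[OF that(3) w1, of 4] by (intro Bernoulli_inequality) simp
    then have "h ^ 4 \<le> (1 - w ^ 4 / 4) ^ 4" using that by simp
    moreover have "0 \<le> 1 - w ^ 4 / 4" using w1 that(3) power_le_one[of w 4] by simp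
    ultimately have "h \<le> 1 - w ^ 4 / 4" using power_mono_iff[of h _ 4] that by simp
    then show ?thesis using h1 w1 by simp
  qed
  note pf = peak[OF fx f0[OF x] u0] and pg = peak[OF gx g0[OF x] v0]
  have diag: "(\<Sum>i\<in>I. f i ^ 3 * g i ^ 3) \<le> 1 - (u ^ 4 + v ^ 4) / 8"
  proof -
    have "(\<Sum>i\<in>I. f i ^ 3 * g i ^ 3) \<le> (\<Sum>i\<in>I. f x * g x * ((f i ^ 4 + g i ^ 4) / 2))"
    proof (rule sum_mono)
      fix i assume i: "i \<in> I"
      have "f i ^ 3 * g i ^ 3 = f i * g i * ((f i)\<^sup>2 * (g i)\<^sup>2)"
        by (simp add: power2_eq_square power3_eq_cube)
      also have "\<dots> \<le> f x * g x * ((f i)\<^sup>2 * (g i)\<^sup>2)"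
        using xmax[OF i] by (intro mult_right_mono) auto
      also have "\<dots> \<le> f x * g x * ((f i ^ 4 + g i ^ 4) / 2)"
        using sum_squares_bound[of "(f i)\<^sup>2" "(g i)\<^sup>2"] f0[OF x] g0[OF x]
        by (intro mult_left_mono) auto
      finally show "f i ^ 3 * g i ^ 3 \<le> f x * g x * ((f i ^ 4 + g i ^ 4) / 2)" .
    qed
    also have "\<dots> = f x * g x"
      by (simp add: sum_distrib_left[symmetric] sum_divide_distrib[symmetric] sum.distrib f1 g1)
    also have "\<dots> \<le> (f x + g x) / 2"
      using mult_left_le[of "g x" "f x"] mult_left_le[of "f x" "g x"] pf pg f0[OF x] g0[OF x]
      by (simp add: mult.commute)
    also have "\<dots> \<le> 1 - (u ^ 4 + v ^ 4) / 8"
      using pf pg by (simp add: field_simps)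
    finally show ?thesis .
  qed
  have small: "h i \<le> w" if "i \<in> J" "0 \<le> w" "(\<Sum>i\<in>J. h i ^ 4) = w ^ 4" "\<And>i. i \<in> I \<Longrightarrow> 0 \<le> h i"
    for h :: "nat \<Rightarrow> real" and w i
  proof -
    have "h i ^ 4 \<le> w ^ 4"
      using member_le_sum[of i J "\<lambda>i. h i ^ 4"] that J(1) by simp
    then show ?thesis using that J power_mono_iff[of "h i" w 4] by auto
  qed
  \<comment> \<open>The row of the peak; by symmetry of the kernel this also bounds its column.\<close>
  have cross: "(\<Sum>j\<in>J. t ^ gap x j * h j ^ 3) \<le> \<kappa> * w ^ 3"
    if "0 \<le> w" "(\<Sum>i\<in>J. h i ^ 4) = w ^ 4" "\<And>i. i \<in> I \<Longrightarrow> 0 \<le> h i" for h :: "nat \<Rightarrow> real" and w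
  proof -
    have "(\<Sum>j\<in>J. t ^ gap x j * h j ^ 3) \<le> (\<Sum>j\<in>J. t ^ gap x j * w ^ 3)"
      using small[OF _ that] that(3) J t by (intro sum_mono mult_left_mono power_mono) auto
    also have "\<dots> \<le> \<kappa> * w ^ 3"
      unfolding sum_distrib_right[symmetric] \<kappa>_def
      using that J t by (intro mult_right_mono sum_power_gap_le) auto
    finally show ?thesis .
  qed
  have six: "(\<Sum>i\<in>J. (h i ^ 3)\<^sup>2) \<le> w ^ 3"
    if "0 \<le> w" "(\<Sum>i\<in>J. h i ^ 4) = w ^ 4" "\<And>i. i \<in> I \<Longrightarrow> 0 \<le> h i" "w \<le> 1"
    for h :: "nat \<Rightarrow> real" and w
  proof -
    have "(\<Sum>i\<in>J. (h i ^ 3)\<^sup>2) = (\<Sum>i\<in>J. (h i)\<^sup>2 * h i ^ 4)"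
      by (intro sum.cong) (auto simp: eval_nat_numeral)
    also have "\<dots> \<le> (\<Sum>i\<in>J. w\<^sup>2 * h i ^ 4)"
      using small[OF _ that(1-3)] that(3) J by (intro sum_mono mult_right_mono power_mono) auto
    also have "\<dots> = w\<^sup>2 * w ^ 4" by (simp add: sum_distrib_left[symmetric] that(2))
    also have "\<dots> = w ^ 6" by (simp add: power_add[symmetric])
    also have "\<dots> \<le> w ^ 3" using that by (intro power_decreasing) auto
    finally show ?thesis .
  qed
  \<comment> \<open>Both indices off the peak: here the squares of the cubes sum to at most \<open>u\<^sup>3\<close> and \<open>v\<^sup>3\<close>.\<close>
  have rest: "(\<Sum>i\<in>J. \<Sum>j\<in>J - {i}. t ^ gap i j * (f i ^ 3 * g j ^ 3)) \<le> \<kappa> * ((u ^ 3 + v ^ 3) / 2)"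
  proof -
    have "(\<Sum>i\<in>J. \<Sum>j\<in>J - {i}. t ^ gap i j * (f i ^ 3 * g j ^ 3))
       \<le> \<kappa> * (((\<Sum>i\<in>J. (f i ^ 3)\<^sup>2) + (\<Sum>i\<in>J. (g i ^ 3)\<^sup>2)) / 2)"
      unfolding \<kappa>_def using J t by (intro off_diagonal_Schur) auto
    also have "\<dots> \<le> \<kappa> * ((u ^ 3 + v ^ 3) / 2)"
      using six[OF u0 u4 f0] six[OF v0 v4 g0] pf pg \<kappa>0
      by (intro mult_left_mono divide_right_mono add_mono) auto
    finally show ?thesis .
  qed
  have split: "(\<Sum>i\<in>I. \<Sum>j\<in>I. t ^ gap i j * (f i ^ 3 * g j ^ 3))
     = (\<Sum>i\<in>I. f i ^ 3 * g i ^ 3)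
       + f x ^ 3 * (\<Sum>j\<in>J. t ^ gap x j * g j ^ 3) + g x ^ 3 * (\<Sum>i\<in>J. t ^ gap x i * f i ^ 3)
       + (\<Sum>i\<in>J. \<Sum>j\<in>J - {i}. t ^ gap i j * (f i ^ 3 * g j ^ 3))"
  proof -
    let ?s = "\<lambda>i j. t ^ gap i j * (f i ^ 3 * g j ^ 3)"
    have inner: "(\<Sum>j\<in>J. ?s i j) = f i ^ 3 * g i ^ 3 + (\<Sum>j\<in>J - {i}. ?s i j)" if "i \<in> J" for i
      using sum.remove[OF J(1) that, of "?s i"] by simp
    have "(\<Sum>i\<in>I. \<Sum>j\<in>I. ?s i j)
       = f x ^ 3 * g x ^ 3 + (\<Sum>j\<in>J. ?s x j) + ((\<Sum>i\<in>J. ?s i x) + (\<Sum>i\<in>J. \<Sum>j\<in>J. ?s i j))"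
      using J unfolding I_eq by (simp add: sum.distrib)
    also have "(\<Sum>i\<in>J. \<Sum>j\<in>J. ?s i j)
       = (\<Sum>i\<in>J. f i ^ 3 * g i ^ 3) + (\<Sum>i\<in>J. \<Sum>j\<in>J - {i}. ?s i j)"
      by (simp add: inner sum.distrib)
    also have "(\<Sum>i\<in>J. ?s i x) = g x ^ 3 * (\<Sum>i\<in>J. t ^ gap x i * f i ^ 3)"
      by (simp add: sum_distrib_left gap_commute[of _ x] mult_ac)
    also have "(\<Sum>j\<in>J. ?s x j) = f x ^ 3 * (\<Sum>j\<in>J. t ^ gap x j * g j ^ 3)"
      by (simp add: sum_distrib_left mult_ac)
    finally show ?thesis using J unfolding I_eq by (simp add: algebra_simps)
  qed
  have c1: "f x ^ 3 * (\<Sum>j\<in>J. t ^ gap x j * g j ^ 3) \<le> 1 * (\<kappa> * v ^ 3)"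
    using cross[OF v0 v4 g0] pf f0[OF x] g0 J t
    by (intro mult_mono power_le_one sum_nonneg) auto
  have c2: "g x ^ 3 * (\<Sum>i\<in>J. t ^ gap x i * f i ^ 3) \<le> 1 * (\<kappa> * u ^ 3)"
    using cross[OF u0 u4 f0] pg g0[OF x] f0 J t
    by (intro mult_mono power_le_one sum_nonneg) auto
  have "(\<Sum>i\<in>I. \<Sum>j\<in>I. t ^ gap i j * (f i ^ 3 * g j ^ 3))
     \<le> 1 - (u ^ 4 + v ^ 4) / 8 + (3 / 2 * \<kappa> * u ^ 3 + 3 / 2 * \<kappa> * v ^ 3)"
    unfolding split using diag c1 c2 rest by (simp add: field_simps)
  also have "\<dots> \<le> 1 + 5184 * \<kappa> ^ 4"
    using cubic_quartic_tradeoff[OF \<kappa>0 u0] cubic_quartic_tradeoff[OF \<kappa>0 v0]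
    by (simp add: field_simps)
  finally show ?thesis by (simp add: \<kappa>_def)
qed

text \<open>
  The homogeneous form, which is the bound for the norm from \<open>l\<^bsup>4/3\<^esup>\<close> to \<open>l\<^sup>4\<close>. In the
  tensor induction, \<open>a i\<close> and \<open>b j\<close> are the cardinalities of the fibres of two sets.
\<close>

lemma geometric_kernel_bound:
  fixes t :: real and a b :: "nat \<Rightarrow> real"
  assumes I: "finite I" and t: "0 \<le> t" "t < 1"
    and a0: "\<And>i. i \<in> I \<Longrightarrow> 0 \<le> a i" and b0: "\<And>i. i \<in> I \<Longrightarrow> 0 \<le> b i"
  shows "(\<Sum>i\<in>I. \<Sum>j\<in>I. t ^ gap i j * (a i * b j) powr (3 / 4))
      \<le> (1 + 5184 * (2 * t / (1 - t)) ^ 4) * ((\<Sum>i\<in>I. a i) * (\<Sum>j\<in>I. b j)) powr (3 / 4)"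
proof -
  define A where "A = (\<Sum>i\<in>I. a i)"
  define B where "B = (\<Sum>i\<in>I. b i)"
  show ?thesis
  proof (cases "A = 0 \<or> B = 0")
    case True
    then have "(\<forall>i\<in>I. a i = 0) \<or> (\<forall>i\<in>I. b i = 0)"
      using I a0 b0 by (auto simp: A_def B_def sum_nonneg_eq_0_iff)
    then have "(\<Sum>i\<in>I. \<Sum>j\<in>I. t ^ gap i j * (a i * b j) powr (3 / 4)) = 0"
      by auto
    then show ?thesis using True unfolding A_def B_def by auto
  next
    case False
    then have AB: "0 < A" "0 < B"
      using a0 b0 by (auto simp: A_def B_def less_le sum_nonneg)
    define f where "f = (\<lambda>i. (a i / A) powr (1 / 4))"
    define g where "g = (\<lambda>i. (b i / B) powr (1 / 4))"
    have pw: "(y powr (1 / 4)) ^ n = y powr (n / 4)" if "0 < n" for y :: real and n :: nat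
      using that by (cases "y = 0") (simp_all add: powr_power)
    have f4: "f i ^ 4 = a i / A" "f i ^ 3 = (a i / A) powr (3 / 4)" if "i \<in> I" for i
      using pw[of 4 "a i / A"] pw[of 3 "a i / A"] a0[OF that] AB by (auto simp: f_def)
    have g4: "g i ^ 4 = b i / B" "g i ^ 3 = (b i / B) powr (3 / 4)" if "i \<in> I" for i
      using pw[of 4 "b i / B"] pw[of 3 "b i / B"] b0[OF that] AB by (auto simp: g_def)
    have "(\<Sum>i\<in>I. \<Sum>j\<in>I. t ^ gap i j * (a i * b j) powr (3 / 4))
       = (\<Sum>i\<in>I. \<Sum>j\<in>I. (A * B) powr (3 / 4) * (t ^ gap i j * (f i ^ 3 * g j ^ 3)))"
    proof (intro sum.cong refl)
      fix i j assume ij: "i \<in> I" "j \<in> I"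
      have "(a i * b j) powr (3 / 4) = ((A * B) * ((a i / A) * (b j / B))) powr (3 / 4)"
        using AB by simp
      also have "\<dots> = (A * B) powr (3 / 4) * (f i ^ 3 * g j ^ 3)"
        using AB a0[OF ij(1)] b0[OF ij(2)] f4[OF ij(1)] g4[OF ij(2)]
        by (simp only: powr_mult)
      finally show "t ^ gap i j * (a i * b j) powr (3 / 4)
          = (A * B) powr (3 / 4) * (t ^ gap i j * (f i ^ 3 * g j ^ 3))" by simp
    qed
    also have "\<dots> = (A * B) powr (3 / 4) * (\<Sum>i\<in>I. \<Sum>j\<in>I. t ^ gap i j * (f i ^ 3 * g j ^ 3))"
      by (simp add: sum_distrib_left)
    also have "\<dots> \<le> (A * B) powr (3 / 4) * (1 + 5184 * (2 * t / (1 - t)) ^ 4)"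
    proof (intro mult_left_mono geometric_kernel_bound_normalized I t)
      show "(\<Sum>i\<in>I. f i ^ 4) = 1" "(\<Sum>i\<in>I. g i ^ 4) = 1"
        using AB by (simp_all add: f4 g4 sum_divide_distrib[symmetric] A_def[symmetric] B_def[symmetric])
    qed (auto simp: f_def g_def)
    finally show ?thesis by (simp add: A_def B_def mult.commute)
  qed
qed

section \<open>Products of geometric kernels\<close>

definition separates :: "'i set \<Rightarrow> ('i \<Rightarrow> 'a \<Rightarrow> nat) \<Rightarrow> 'a set \<Rightarrow> bool" where
  "separates T v A \<longleftrightarrow> (\<forall>x\<in>A. \<forall>y\<in>A. (\<forall>p\<in>T. v p x = v p y) \<longrightarrow> x = y)"

text \<open>
  The norm bounds multiply: sort \<open>A\<close> and \<open>B\<close> by one coordinate \<open>q\<close>, apply the induction hypothesis to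
  each pair of fibres, and then the bound for a single kernel to the cardinalities of the fibres. The
  induction ends at \<open>T = {}\<close>, where separation leaves at most one point in either set.
\<close>

lemma product_kernel_bound:
  fixes t :: "'i \<Rightarrow> real" and v :: "'i \<Rightarrow> 'a \<Rightarrow> nat" and w :: "'i \<Rightarrow> 'b \<Rightarrow> nat"
  assumes "finite T" "finite A" "finite B" "separates T v A" "separates T w B"
    and t0: "\<And>p. p \<in> T \<Longrightarrow> 0 \<le> t p" and t1: "\<And>p. p \<in> T \<Longrightarrow> t p < 1"
  shows "(\<Sum>x\<in>A. \<Sum>y\<in>B. \<Prod>p\<in>T. t p ^ gap (v p x) (w p y))
      \<le> (\<Prod>p\<in>T. 1 + 5184 * (2 * t p / (1 - t p)) ^ 4) * (real (card A) * real (card B)) powr (3 / 4)"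
  using assms
proof (induction T arbitrary: A B rule: finite_induct)
  case empty
  have one: "card X \<le> 1" if "finite X" "separates {} u X" for X :: "'c set" and u :: "'i \<Rightarrow> 'c \<Rightarrow> nat"
    using that card_le_Suc0_iff_eq[of X] by (auto simp: separates_def)
  have "card A = 0 \<or> card A = 1" "card B = 0 \<or> card B = 1"
    using one[OF empty(1,3)] one[OF empty(2,4)] by auto
  then show ?case by auto
next
  case (insert q T)
  let ?K = "\<lambda>x y. \<Prod>p\<in>T. t p ^ gap (v p x) (w p y)"
  let ?C = "\<lambda>p. 1 + 5184 * (2 * t p / (1 - t p)) ^ 4"
  define I where "I = v q ` A \<union> w q ` B"
  define A' where "A' = (\<lambda>i. {x\<in>A. v q x = i})"
  define B' where "B' = (\<lambda>j. {y\<in>B. w q y = j})"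
  have I: "finite I" "v q ` A \<subseteq> I" "w q ` B \<subseteq> I"
    using insert.prems by (auto simp: I_def)
  have sumA: "(\<Sum>i\<in>I. sum h (A' i)) = sum h A" for h :: "'a \<Rightarrow> real"
    unfolding A'_def using insert.prems(1) I by (intro sum.group) auto
  have sumB: "(\<Sum>j\<in>I. sum h (B' j)) = sum h B" for h :: "'b \<Rightarrow> real"
    unfolding B'_def using insert.prems(2) I by (intro sum.group) auto
  have cardA: "(\<Sum>i\<in>I. real (card (A' i))) = real (card A)"
    using sumA[of "\<lambda>_. 1"] by simp
  have cardB: "(\<Sum>j\<in>I. real (card (B' j))) = real (card B)"
    using sumB[of "\<lambda>_. 1"] by simp
  have C0: "0 \<le> prod ?C T"
    by (intro prod_nonneg) auto
  have IH: "(\<Sum>x\<in>A' i. \<Sum>y\<in>B' j. ?K x y)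
      \<le> prod ?C T * (real (card (A' i)) * real (card (B' j))) powr (3 / 4)" for i j
    using insert.prems by (intro insert.IH) (auto simp: A'_def B'_def separates_def)
  have "(\<Sum>x\<in>A. \<Sum>y\<in>B. \<Prod>p\<in>insert q T. t p ^ gap (v p x) (w p y))
     = (\<Sum>x\<in>A. \<Sum>y\<in>B. t q ^ gap (v q x) (w q y) * ?K x y)"
    using insert.hyps by simp
  also have "\<dots> = (\<Sum>i\<in>I. \<Sum>x\<in>A' i. \<Sum>j\<in>I. \<Sum>y\<in>B' j. t q ^ gap (v q x) (w q y) * ?K x y)"
    by (simp only: sumA sumB)
  also have "\<dots> = (\<Sum>i\<in>I. \<Sum>x\<in>A' i. \<Sum>j\<in>I. \<Sum>y\<in>B' j. t q ^ gap i j * ?K x y)"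
    by (intro sum.cong refl) (simp add: A'_def B'_def)
  also have "\<dots> = (\<Sum>i\<in>I. \<Sum>j\<in>I. \<Sum>x\<in>A' i. \<Sum>y\<in>B' j. t q ^ gap i j * ?K x y)"
    by (intro sum.cong refl sum.swap)
  also have "\<dots> = (\<Sum>i\<in>I. \<Sum>j\<in>I. t q ^ gap i j * (\<Sum>x\<in>A' i. \<Sum>y\<in>B' j. ?K x y))"
    by (simp add: sum_distrib_left)
  also have "\<dots> \<le> (\<Sum>i\<in>I. \<Sum>j\<in>I. t q ^ gap i j *
      (prod ?C T * (real (card (A' i)) * real (card (B' j))) powr (3 / 4)))"
    using IH insert.prems(5) by (intro sum_mono mult_left_mono) auto
  also have "\<dots> = prod ?C T *
      (\<Sum>i\<in>I. \<Sum>j\<in>I. t q ^ gap i j * (real (card (A' i)) * real (card (B' j))) powr (3 / 4))"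
    by (simp add: sum_distrib_left sum_distrib_right mult_ac)
  also have "\<dots> \<le> prod ?C T * (?C q * (real (card A) * real (card B)) powr (3 / 4))"
    unfolding cardA[symmetric] cardB[symmetric] using insert.prems(5,6) I C0
    by (intro mult_left_mono geometric_kernel_bound) auto
  also have "\<dots> = prod ?C (insert q T) * (real (card A) * real (card B)) powr (3 / 4)"
    using insert.hyps by simp
  finally show ?case .
qed

text \<open>
  A form of Bondy's theorem, by adding one point at a time. (For nonempty
  \<open>A\<close> the optimal bound is \<open>card A - 1\<close>; the loss of one is harmless.)
\<close>

lemma few_coordinates_separate:
  fixes v :: "'i \<Rightarrow> 'a \<Rightarrow> nat"
  assumes "finite A" "separates P v A"
  shows "\<exists>T\<subseteq>P. finite T \<and> card T \<le> card A \<and> separates T v A"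
  using assms
proof (induction A rule: finite_induct)
  case empty
  show ?case by (intro exI[of _ "{}"]) (simp add: separates_def)
next
  case (insert x A)
  then obtain T where T: "T \<subseteq> P" "finite T" "card T \<le> card A" "separates T v A"
    by (auto simp: separates_def)
  show ?case
  proof (cases "\<exists>y\<in>A. \<forall>p\<in>T. v p x = v p y")
    case False
    then have "separates T v (insert x A)"
      using T(4) unfolding separates_def by (metis insert_iff)
    then show ?thesis using T insert.hyps by (intro exI[of _ T]) auto
  next
    case True
    then obtain y where y: "y \<in> A" "\<forall>p\<in>T. v p x = v p y" by blast
    have "x \<noteq> y" using y insert.hyps by blast
    then obtain q where q: "q \<in> P" "v q x \<noteq> v q y"
      using insert.prems y(1) unfolding separates_def by (metis insert_iff)
    \<comment> \<open>As \<open>T\<close> separates \<open>A\<close>, the point \<open>x\<close> collides with \<open>y\<close> only, so one more coordinate suffices.\<close>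
    have coll: "z = y" if "z \<in> A" "\<forall>p\<in>T. v p x = v p z" for z
      using T(4) y that unfolding separates_def by metis
    have "separates (insert q T) v (insert x A)"
      unfolding separates_def
    proof (intro ballI impI)
      fix a b assume ab: "a \<in> insert x A" "b \<in> insert x A" "\<forall>p\<in>insert q T. v p a = v p b"
      show "a = b"
      proof (cases "a = x"; cases "b = x")
        assume "a \<noteq> x" "b \<noteq> x"
        then show ?thesis using ab T(4) unfolding separates_def by auto
      next
        assume "a = x" "b \<noteq> x"
        then show ?thesis using ab coll[of b] q by auto
      next
        assume "a \<noteq> x" "b = x"
        then show ?thesis using ab coll[of a] q by auto
      qed simp
    qed
    moreover have "card (insert q T) \<le> card (insert x A)"
      using T insert.hyps by (simp add: card_insert_if)
    ultimately show ?thesis using T q by (intro exI[of _ "insert q T"]) auto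
  qed
qed

section \<open>The gcd weight as a product over primes\<close>

text \<open>
  Used with \<open>e = 1\<close> for the primes dividing a binomial coefficient, and with the valuation distances for
  the gcd weight.
\<close>

lemma prod_prime_powers_dvd:
  fixes x :: nat
  assumes "finite T" "\<And>p. p \<in> T \<Longrightarrow> prime p" "\<And>p. p \<in> T \<Longrightarrow> p ^ e p dvd x"
  shows "(\<Prod>p\<in>T. p ^ e p) dvd x"
  using assms
proof (induction T rule: finite_induct)
  case (insert q T)
  have "coprime (q ^ e q) (\<Prod>p\<in>T. p ^ e p)"
    using insert.prems insert.hyps
    by (intro prod_coprime_right coprime_power_left_iff[THEN iffD2] disjI1
        coprime_power_right_iff[THEN iffD2] primes_coprime) auto
  then show ?case using insert by (simp add: divides_mult)
qed simp

text \<open>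
  Write \<open>m = g a\<close> and \<open>n = g b\<close> with \<open>g = (m,n)\<close>. The weight is \<open>(ab)\<^bsup>-1/4\<^esup>\<close>, and the prime powers
  \<open>p\<^bsup>|v\<^sub>p(m) - v\<^sub>p(n)|\<^esup>\<close> over \<open>p \<in> T\<close> multiply to a divisor of \<open>ab\<close>. There is equality when \<open>T\<close>
  contains all primes dividing \<open>mn\<close>.
\<close>

lemma gcd_weight_le_prime_kernel:
  fixes m n :: nat
  assumes "0 < m" "0 < n" "finite T" "\<And>p. p \<in> T \<Longrightarrow> prime p"
  shows "real (gcd m n) powr (1 / 2) / (real m * real n) powr (1 / 4)
    \<le> (\<Prod>p\<in>T. (real p powr (- 1 / 4)) ^ gap (multiplicity p m) (multiplicity p n))"
proof -
  define g where "g = gcd m n"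
  define a where "a = m div g"
  define b where "b = n div g"
  have m: "m = g * a" and n: "n = g * b" by (simp_all add: g_def a_def b_def)
  have pos: "0 < g" "0 < a" "0 < b" using assms(1,2) m n by auto
  define e where "e = (\<lambda>p. gap (multiplicity p m) (multiplicity p n))"
  have dvd: "(\<Prod>p\<in>T. p ^ e p) dvd a * b"
  proof (rule prod_prime_powers_dvd[OF assms(3,4)])
    fix p assume p: "p \<in> T"
    have "multiplicity p m = multiplicity p g + multiplicity p a"
      "multiplicity p n = multiplicity p g + multiplicity p b"
      "multiplicity p (a * b) = multiplicity p a + multiplicity p b"
      using pos assms(4)[OF p] by (simp_all add: m n prime_elem_multiplicity_mult_distrib)
    then have "e p \<le> multiplicity p (a * b)" by (simp add: e_def gap_def)
    then show "p ^ e p dvd a * b" by (rule multiplicity_dvd')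
  qed
  have le: "real (\<Prod>p\<in>T. p ^ e p) \<le> real (a * b)"
    using dvd_imp_le[OF dvd] pos by (simp only: of_nat_le_iff) simp
  have T0: "0 < real p" if "p \<in> T" for p using assms(4)[OF that] prime_gt_0_nat by simp
  have "real g powr (1 / 2) / (real m * real n) powr (1 / 4) = real (a * b) powr (- 1 / 4)"
  proof -
    have "(real m * real n) powr (1 / 4) = ((real g)\<^sup>2 * real (a * b)) powr (1 / 4)"
      by (simp add: m n power2_eq_square mult_ac)
    also have "\<dots> = real g powr (1 / 2) * real (a * b) powr (1 / 4)"
      using pos by (simp add: powr_mult powr_powr flip: powr_numeral)
    finally show ?thesis using pos by (simp add: powr_minus_divide)
  qed
  also have "\<dots> \<le> real (\<Prod>p\<in>T. p ^ e p) powr (- 1 / 4)"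
    using le T0 by (intro powr_mono2') (auto intro!: prod_pos)
  also have "\<dots> = (\<Prod>p\<in>T. (real p powr (- 1 / 4)) ^ e p)"
    using T0 by (simp add: prod_powr_distrib powr_power powr_powr mult.commute flip: powr_realpow)
  finally show ?thesis by (simp add: g_def e_def)
qed

section \<open>Sums of reciprocals of primes\<close>

text \<open>
  Chebyshev's argument: with \<open>n = 2\<^bsup>k\<^esup>\<close>, the product of the primes in \<open>(n, 2n]\<close> divides the central
  binomial coefficient, which is at most \<open>4\<^bsup>n\<^esup>\<close>, while each of these primes exceeds \<open>n\<close>.
\<close>

lemma card_primes_dyadic_le:
  assumes "1 \<le> k"
  shows "real (card {p::nat. prime p \<and> 2 ^ k < p \<and> p \<le> 2 ^ Suc k}) \<le> 2 ^ Suc k / real k"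
proof -
  define n where "n = (2::nat) ^ k"
  define D where "D = {p::nat. prime p \<and> n < p \<and> p \<le> 2 * n}"
  have fin: "finite D" by (rule finite_subset[of _ "{..2 * n}"]) (auto simp: D_def)
  have "p dvd (2 * n choose n)" if "p \<in> D" for p
  proof -
    have p: "prime p" "n < p" "p \<le> 2 * n" using that by (auto simp: D_def)
    have "p dvd fact (2 * n)" using p prime_dvd_fact_iff by blast
    also have "(fact (2 * n) :: nat) = fact n * fact n * (2 * n choose n)"
      using binomial_fact_lemma[of n "2 * n"] by simp
    finally show ?thesis
      using p prime_dvd_fact_iff[of p n] by (auto simp: prime_dvd_mult_iff)
  qed
  then have "(\<Prod>p\<in>D. p ^ 1) dvd (2 * n choose n)"
    using fin by (intro prod_prime_powers_dvd) (auto simp: D_def)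
  then have "(\<Prod>p\<in>D. p) \<le> (2 * n choose n)"
    by (intro dvd_imp_le) auto
  also have "\<dots> \<le> 2 ^ (2 * n)" by (rule binomial_le_pow2)
  finally have upper: "(\<Prod>p\<in>D. p) \<le> 2 ^ (2 * n)" .
  have "2 ^ (k * card D) = (\<Prod>p\<in>D. n)"
    by (simp add: n_def power_mult)
  also have "\<dots> \<le> (\<Prod>p\<in>D. p)"
    by (intro prod_mono) (auto simp: D_def)
  also note upper
  finally have "k * card D \<le> 2 * n" by simp
  then have "real (k * card D) \<le> real (2 * n)"
    by (simp only: of_nat_le_iff)
  then show ?thesis
    using assms by (simp add: D_def n_def field_simps)
qed

lemma sum_reciprocals_le_ln:
  "(\<Sum>k=1..n. 1 / real k) \<le> 1 + ln (real n)" if "1 \<le> n"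
  using that
proof (induction n rule: dec_induct)
  case (step n)
  have "ln (real n / real (Suc n)) \<le> real n / real (Suc n) - 1"
    using step by (intro ln_le_minus_one) auto
  also have "\<dots> = - 1 / real (Suc n)" by (simp add: field_simps)
  finally have "1 / real (Suc n) \<le> ln (real (Suc n)) - ln (real n)"
    using step by (simp add: ln_div)
  then show ?case using step by simp
qed simp

text \<open>
  By the dyadic count, the primes in \<open>(2\<^bsup>k\<^esup>, 2\<^bsup>k+1\<^esup>]\<close> contribute at most \<open>2/k\<close> for \<open>k \<ge> 1\<close>. This gives \<open>log log\<close>
  growth in the length of the interval, with a constant \<open>2\<close> in place of the \<open>1\<close> in Mertens' theorem.
\<close>

lemma sum_prime_reciprocals_dyadic_le:
  assumes "1 \<le> K"
  shows "(\<Sum>p | prime p \<and> p \<le> 2 ^ K. 1 / real p) \<le> 3 + 2 * ln (real K)"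
proof -
  define D where "D = (\<lambda>k. {p::nat. prime p \<and> 2 ^ k < p \<and> p \<le> 2 ^ Suc k})"
  have fin: "finite {p::nat. prime p \<and> p \<le> N}" for N
    by (rule finite_subset[of _ "{..N}"]) auto
  have finD: "finite (D k)" for k
    by (rule finite_subset[OF _ fin[of "2 ^ Suc k"]]) (auto simp: D_def)
  have block: "(\<Sum>p\<in>D k. 1 / real p) \<le> 2 * (1 / real k)" if "1 \<le> k" for k
  proof -
    have "(\<Sum>p\<in>D k. 1 / real p) \<le> real (card (D k)) * (1 / 2 ^ k)"
    proof (rule sum_bounded_above)
      fix p assume "p \<in> D k"
      then have "2 ^ k \<le> p" by (simp add: D_def)
      then have "real (2 ^ k) \<le> real p" by (simp only: of_nat_le_iff)
      then show "1 / real p \<le> 1 / 2 ^ k" by (simp add: frac_le)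
    qed
    also have "\<dots> \<le> 2 ^ Suc k / real k * (1 / 2 ^ k)"
      using card_primes_dyadic_le[OF that] by (intro mult_right_mono) (auto simp: D_def)
    finally show ?thesis by simp
  qed
  have "(\<Sum>p | prime p \<and> p \<le> 2 ^ K. 1 / real p) \<le> 1 / 2 + (\<Sum>k=1..<K. 2 * (1 / real k))"
    using assms
  proof (induction K rule: dec_induct)
    case base
    have "{p::nat. prime p \<and> p \<le> 2 ^ 1} = {2}"
      by (auto dest: prime_ge_2_nat intro: antisym)
    then show ?case by (simp only:) simp
  next
    case (step K)
    have "{p::nat. prime p \<and> p \<le> 2 ^ Suc K} = {p. prime p \<and> p \<le> 2 ^ K} \<union> D K"
      by (auto simp: D_def)
    then have "(\<Sum>p | prime p \<and> p \<le> 2 ^ Suc K. 1 / real p)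
       = (\<Sum>p | prime p \<and> p \<le> 2 ^ K. 1 / real p) + (\<Sum>p\<in>D K. 1 / real p)"
      using fin finD by (simp only:) (intro sum.union_disjoint, auto simp: D_def)
    then show ?case using step block[of K] by simp
  qed
  also have "(\<Sum>k=1..<K. 2 * (1 / real k)) \<le> 2 * (\<Sum>k=1..K. 1 / real k)"
    unfolding sum_distrib_left by (intro sum_mono2) auto
  also have "\<dots> \<le> 2 * (1 + ln (real K))"
    using sum_reciprocals_le_ln[OF assms] by simp
  finally show ?thesis by simp
qed

text \<open>
  For an arbitrary set of at most \<open>2\<^bsup>K\<^esup>\<close> primes: those beyond \<open>2\<^bsup>K\<^esup>\<close> contribute at most \<open>1\<close> in total,
  however large they are.
\<close>

lemma sum_prime_reciprocals_le:
  assumes "finite T" "\<And>p. p \<in> T \<Longrightarrow> prime p" "card T \<le> 2 ^ K" "1 \<le> K"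
  shows "(\<Sum>p\<in>T. 1 / real p) \<le> 4 + 2 * ln (real K)"
proof -
  have fin: "finite {p::nat. prime p \<and> p \<le> 2 ^ K}"
    by (rule finite_subset[of _ "{..2 ^ K}"]) auto
  let ?S = "{p\<in>T. p \<le> 2 ^ K}" and ?L = "{p\<in>T. 2 ^ K < p}"
  have "(\<Sum>p\<in>T. 1 / real p) = (\<Sum>p\<in>?S \<union> ?L. 1 / real p)"
    by (intro sum.cong) auto
  also have "\<dots> = (\<Sum>p\<in>?S. 1 / real p) + (\<Sum>p\<in>?L. 1 / real p)"
    using assms(1) by (intro sum.union_disjoint) auto
  also have "(\<Sum>p\<in>?S. 1 / real p) \<le> (\<Sum>p | prime p \<and> p \<le> 2 ^ K. 1 / real p)"
    using assms(2) by (intro sum_mono2 fin) auto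
  also have "\<dots> \<le> 3 + 2 * ln (real K)"
    by (rule sum_prime_reciprocals_dyadic_le[OF assms(4)])
  also have "(\<Sum>p\<in>?L. 1 / real p) \<le> real (card ?L) * (1 / 2 ^ K)"
  proof (rule sum_bounded_above)
    fix p assume "p \<in> ?L"
    then have "2 ^ K \<le> p" by simp
    then have "real (2 ^ K) \<le> real p" by (simp only: of_nat_le_iff)
    then show "1 / real p \<le> 1 / 2 ^ K" by (simp add: frac_le)
  qed
  also have "\<dots> \<le> 2 ^ K * (1 / 2 ^ K)"
  proof (intro mult_right_mono)
    have "card ?L \<le> card T" using assms(1) by (intro card_mono) auto
    then have "real (card ?L) \<le> real (2 ^ K)" using assms(3) by (simp only: of_nat_le_iff)
    then show "real (card ?L) \<le> 2 ^ K" by simp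
  qed simp
  finally show ?thesis by simp
qed

section \<open>The gcd sum\<close>

text \<open>
  For \<open>t = p\<^bsup>-1/4\<^esup>\<close> the fourth power of \<open>t\<close> is \<open>1/p\<close>. Since \<open>t \<le> 9/10\<close> even for \<open>p = 2\<close>, the quantity
  \<open>\<kappa> = 2t / (1 - t)\<close> is at most \<open>20 t\<close>, and \<open>829440000 = 5184 * 20\<^sup>4\<close>.
\<close>

lemma prime_factor_constant_le:
  fixes p :: nat
  assumes "prime p"
  defines "t \<equiv> real p powr (- 1 / 4)"
  shows "0 \<le> t" "t < 1" "1 + 5184 * (2 * t / (1 - t)) ^ 4 \<le> 1 + 829440000 * (1 / real p)"
proof -
  have p: "2 \<le> real p" using prime_ge_2_nat[OF assms(1)] by simp
  have "t ^ 4 = real p powr (- 1)"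
    unfolding t_def using p by (subst powr_power) auto
  then have t4: "t ^ 4 = 1 / real p"
    using p by (simp add: powr_minus_divide)
  show t0: "0 \<le> t" by (simp add: t_def)
  have "t ^ 4 \<le> 1 / 2" using p by (simp add: t4 field_simps)
  also have "\<dots> \<le> (9 / 10 :: real) ^ 4" by (simp add: power4_eq_xxxx)
  finally have t9: "t \<le> 9 / 10" using t0 power_mono_iff[of t "9 / 10" 4] by simp
  then show "t < 1" by simp
  have "2 * t / (1 - t) \<le> 2 * t / (1 / 10)"
    using t0 t9 by (intro divide_left_mono) auto
  then have "(2 * t / (1 - t)) ^ 4 \<le> (20 * t) ^ 4"
    using t0 t9 by (intro power_mono) auto
  also have "\<dots> = 160000 * (1 / real p)"
    by (simp add: power_mult_distrib t4)
  finally show "1 + 5184 * (2 * t / (1 - t)) ^ 4 \<le> 1 + 829440000 * (1 / real p)"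
    by simp
qed

text \<open>
  The bound for arbitrary finite sets of positive integers; it depends on the primes involved
  only through their number, which is at most \<open>card A + card B\<close>.
\<close>

lemma gcd_sum_bound:
  assumes A: "finite A" "\<And>m. m \<in> A \<Longrightarrow> 0 < m" and B: "finite B" "\<And>n. n \<in> B \<Longrightarrow> 0 < n"
    and K: "card A + card B \<le> 2 ^ K" "1 \<le> K"
  shows "(\<Sum>m\<in>A. \<Sum>n\<in>B. real (gcd m n) powr (1 / 2) / (real m * real n) powr (1 / 4))
    \<le> exp (829440000 * (4 + 2 * ln (real K))) * (real (card A) * real (card B)) powr (3 / 4)"
proof -
  let ?v = "multiplicity :: nat \<Rightarrow> nat \<Rightarrow> nat"
  let ?t = "\<lambda>p. real p powr (- 1 / 4)"
  have sep: "separates {p. prime p} ?v X" if "\<And>m. m \<in> X \<Longrightarrow> 0 < m" for X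
    unfolding separates_def
  proof (intro ballI impI)
    fix x y assume "x \<in> X" "y \<in> X" "\<forall>p\<in>{p. prime p}. ?v p x = ?v p y"
    then show "x = y"
      using multiplicity_eq_nat[OF that that, of x y] by blast
  qed
  obtain T1 where T1: "T1 \<subseteq> {p. prime p}" "finite T1" "card T1 \<le> card A" "separates T1 ?v A"
    using few_coordinates_separate[OF A(1) sep[OF A(2)]] by blast
  obtain T2 where T2: "T2 \<subseteq> {p. prime p}" "finite T2" "card T2 \<le> card B" "separates T2 ?v B"
    using few_coordinates_separate[OF B(1) sep[OF B(2)]] by blast
  define T where "T = T1 \<union> T2"
  have T: "finite T" "\<And>p. p \<in> T \<Longrightarrow> prime p" "separates T ?v A" "separates T ?v B"
    using T1 T2 by (auto simp: T_def separates_def)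
  have "card T \<le> 2 ^ K"
    using card_Un_le[of T1 T2] T1(3) T2(3) K(1) by (simp add: T_def)
  note reciprocals = sum_prime_reciprocals_le[OF T(1,2) this K(2)]
  have "(\<Sum>m\<in>A. \<Sum>n\<in>B. real (gcd m n) powr (1 / 2) / (real m * real n) powr (1 / 4))
      \<le> (\<Sum>m\<in>A. \<Sum>n\<in>B. \<Prod>p\<in>T. ?t p ^ gap (?v p m) (?v p n))"
    using A(2) B(2) T by (intro sum_mono gcd_weight_le_prime_kernel) auto
  also have "\<dots> \<le> (\<Prod>p\<in>T. 1 + 5184 * (2 * ?t p / (1 - ?t p)) ^ 4)
      * (real (card A) * real (card B)) powr (3 / 4)"
    using T A B by (intro product_kernel_bound prime_factor_constant_le) auto
  also have "(\<Prod>p\<in>T. 1 + 5184 * (2 * ?t p / (1 - ?t p)) ^ 4)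
      \<le> (\<Prod>p\<in>T. exp (829440000 * (1 / real p)))"
  proof (intro prod_mono conjI)
    fix p assume "p \<in> T"
    then show "1 + 5184 * (2 * ?t p / (1 - ?t p)) ^ 4 \<le> exp (829440000 * (1 / real p))"
      using prime_factor_constant_le(3)[OF T(2)] exp_ge_add_one_self order_trans by blast
  qed auto
  also have "\<dots> = exp (829440000 * (\<Sum>p\<in>T. 1 / real p))"
    using T(1) by (simp only: exp_sum sum_distrib_left)
  also have "\<dots> \<le> exp (829440000 * (4 + 2 * ln (real K)))"
    using reciprocals by simp
  finally show ?thesis by (simp add: mult_right_mono)
qed

theorem lemma4:
  "\<exists>b2::real. b2 > 0 \<and> (\<exists>C::real. \<forall>(M1::nat set) (M2::nat set) (k1::nat) (k2::nat) (R::real).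
     finite M1 \<longrightarrow> finite M2 \<longrightarrow> (\<forall>m\<in>M1. 0 < m) \<longrightarrow> (\<forall>n\<in>M2. 0 < n) \<longrightarrow>
     card M1 \<le> card M2 \<longrightarrow>
     0 < k1 \<longrightarrow> 0 < k2 \<longrightarrow>
     M1 \<subseteq> {2 ^ k1..2 ^ (k1 + 1)} \<longrightarrow> M2 \<subseteq> {2 ^ k2..2 ^ (k2 + 1)} \<longrightarrow>
     1 < R \<longrightarrow>
     C < real (card M1) \<longrightarrow> C < real (card M2) \<longrightarrow>
     (\<Sum>(m, n)\<in>{(m, n). m \<in> M1 \<and> n \<in> M2 \<and>
          R \<le> real (gcd m n) \<and> real (gcd m n) \<le> R * log1 (real (card M2))}.
        real (gcd m n) powr (1 / 2) / (real m * real n) powr (1 / 4))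
     \<le> (real (card M1) * real (card M2)) powr (3 / 4) * log1 (real (card M2)) powr b2)"
  \<comment> \<open>The threshold \<open>exp 4\<close> makes \<open>l = log N2\<close> at least \<open>4\<close>, enough for \<open>K \<le> l\<^sup>2\<close> and \<open>1 \<le> log l\<close> below.\<close>
proof (rule exI[of _ "829440000 * 8 :: real"], intro conjI exI[of _ "exp 4 :: real"] allI impI)
  fix M1 M2 :: "nat set" and k1 k2 :: nat and R :: real
  assume fin: "finite M1" "finite M2" and pos: "\<forall>m\<in>M1. 0 < m" "\<forall>n\<in>M2. 0 < n"
    and le: "card M1 \<le> card M2" and big: "exp 4 < real (card M2)"
  let ?w = "\<lambda>(m, n). real (gcd m n) powr (1 / 2) / (real m * real n) powr (1 / 4)"
  define N where "N = card M2"
  define l where "l = ln (real N)"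
  have N0: "0 < real N" unfolding N_def by (rule less_trans[OF exp_gt_zero big])
  have N1: "1 \<le> real N" using N0 by simp
  have l4: "4 \<le> l"
    using big N0 ln_ge_iff[of "real N" 4] by (simp add: l_def N_def)
  \<comment> \<open>\<open>2\<^bsup>K\<^esup>\<close> is the least power of \<open>2\<close> that is at least \<open>2 N\<close>, hence at least \<open>N1 + N2\<close>.\<close>
  define K where "K = nat \<lceil>log 2 (2 * real N)\<rceil>"
  have log_ge: "0 \<le> log 2 (2 * real N)"
    using N1 by simp
  have K_lower: "log 2 (2 * real N) \<le> real K" by (simp add: K_def real_nat_ceiling_ge)
  have K_upper: "real K \<le> log 2 (2 * real N) + 1"
    using log_ge unfolding K_def by linarith
  have cardK: "card M1 + card M2 \<le> 2 ^ K"
  proof -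
    have "2 * real N \<le> 2 powr real K"
      using K_lower N0 by (simp add: le_powr_iff)
    then have "real (2 * N) \<le> real (2 ^ K)" by (simp add: powr_realpow)
    then have "2 * N \<le> 2 ^ K" by (simp only: of_nat_le_iff)
    then show ?thesis using le by (simp add: N_def)
  qed
  have K1: "1 \<le> K"
  proof -
    have "1 \<le> log 2 (2 * real N)" using N1 by simp
    then have "1 \<le> real K" using K_lower by linarith
    then show ?thesis by simp
  qed
  have K_le: "real K \<le> l\<^sup>2"
  proof -
    have "log 2 (2 * real N) = 1 + l / ln 2"
      using N0 by (simp add: log_def ln_mult l_def add_divide_distrib)
    moreover have "1 / 2 \<le> ln (2::real)"
      using ln_le_minus_one[of "1 / 2 :: real"] by (simp add: ln_div)
    then have "l / ln 2 \<le> l / (1 / 2)"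
      using l4 by (intro divide_left_mono) auto
    ultimately have "real K \<le> 2 + 2 * l" using K_upper by simp
    also have "\<dots> \<le> l\<^sup>2"
    proof -
      have "4 * l \<le> l * l" using l4 by (intro mult_right_mono) auto
      then have "2 + 2 * l \<le> l * l" using l4 by linarith
      then show ?thesis by (simp add: power2_eq_square)
    qed
    finally show ?thesis .
  qed
  \<comment> \<open>With \<open>log l \<ge> 1\<close> the constant \<open>4\<close> is absorbed: \<open>4 + 2 log K \<le> 8 log l\<close>, whence the exponent.\<close>
  have "exp 1 \<le> l" using exp_le l4 by linarith
  then have lnl: "1 \<le> ln l" using l4 by (simp add: ln_ge_iff)
  have lnK: "ln (real K) \<le> 2 * ln l"
  proof -
    have "ln (real K) \<le> ln (l\<^sup>2)" using K_le K1 by (intro ln_mono) auto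
    then show ?thesis using l4 by (simp add: ln_realpow)
  qed
  have log1: "log1 (real (card M2)) = l"
    using l4 by (simp add: log1_def l_def N_def)
  have "(\<Sum>x\<in>{(m, n). m \<in> M1 \<and> n \<in> M2 \<and>
          R \<le> real (gcd m n) \<and> real (gcd m n) \<le> R * log1 (real (card M2))}. ?w x)
      \<le> (\<Sum>x\<in>M1 \<times> M2. ?w x)"
    using fin by (intro sum_mono2) auto
  also have "\<dots> = (\<Sum>m\<in>M1. \<Sum>n\<in>M2. ?w (m, n))"
    by (simp add: sum.cartesian_product)
  also have "\<dots> \<le> exp (829440000 * (4 + 2 * ln (real K))) * (real (card M1) * real (card M2)) powr (3 / 4)"
    using gcd_sum_bound[OF fin(1) _ fin(2) _ cardK K1] pos by simp
  also have "exp (829440000 * (4 + 2 * ln (real K))) \<le> exp (829440000 * 8 * ln l)"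
    using lnK lnl by simp
  also have "exp (829440000 * 8 * ln l) = l powr (829440000 * 8)"
    using l4 by (simp add: powr_def)
  finally show "(\<Sum>(m, n)\<in>{(m, n). m \<in> M1 \<and> n \<in> M2 \<and>
          R \<le> real (gcd m n) \<and> real (gcd m n) \<le> R * log1 (real (card M2))}.
        real (gcd m n) powr (1 / 2) / (real m * real n) powr (1 / 4))
     \<le> (real (card M1) * real (card M2)) powr (3 / 4) * log1 (real (card M2)) powr (829440000 * 8)"
    by (simp only: log1) (simp add: mult_right_mono mult.commute)
qed simp

end
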